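(* The map $$c:\mathcal W\longrightarrow\mathcal T\times\mathbb H_{\mathbb Z},\qquad c(w)=(\tau_w,h(w)),$$ is a monoid homomorphism and $$\Delta_{\mathcal W}\subsetneq\ \sim_c\ \subsetneq\ \sim_\tau.$$
   Context: $Q_3$ is the $1$-skeleton (graph) of the three-dimensional cube, with vertex set $V=\{0,1\}^3$ and coordinates numbered $0,1,2$; a vertex is written $b_2b_1b_0$ with $b_i$ the $i$-th coordinate, and two vertices are adjacent iff they differ in exactly one coordinate. The basepoint is $o=000$. A walk is $w=(o;a_1a_2\cdots a_n)$ with $n\ge0$, $a_k\in\{0,1,2\}$; its vertex sequence is $v_0=o,v_1,\ldots,v_n$, where $v_k$ is obtained from $v_{k-1}$ by flipping coordinate $a_k$. It is closed if $v_n=o$. $\mathcal W$ is the monoid of based closed walks under concatenation of step sequences, with identity the empty walk $1$; two walks are equal iff their step sequences coincide. Directed transition count: $\tau_w:V\times V\to\mathbb N$, $\tau_w(p,q)=\#\{k:1\le k\le n,\ (v_{k-1},v_k)=(p,q)\}$. $\mathcal T=\{\tau_w:w\in\mathcal W\}\subseteq\mathbb N^{V\times V}$ is a monoid under pointwise addition. $\mathbb H_{\mathbb Z}=\{a+b\mathbf i+c\mathbf j+d\mathbf k:a,b,c,d\in\mathbb Z\}$ is the multiplicative monoid of integer quaternions, with $\mathbf i^2=\mathbf j^2=\mathbf k^2=-1$, $\mathbf i\mathbf j=\mathbf k$, $\mathbf j\mathbf k=\mathbf i$, $\mathbf k\mathbf i=\mathbf j$. Put $q_0=1+\mathbf i$,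 $q_1=1+\mathbf j$, $q_2=1+\mathbf k$ and, for $w=(o;a_1\cdots a_n)$, $h(w)=q_{a_1}\cdots q_{a_n}\in\mathbb H_{\mathbb Z}$. For a map $r$ on $\mathcal W$, $x\sim_r y\iff r(x)=r(y)$; in particular $u\sim_\tau v\iff\tau_u=\tau_v$. $\Delta_{\mathcal W}$ is equality on $\mathcal W$. Relations are compared as subsets of $\mathcal W\times\mathcal W$; the product $\mathcal T\times\mathbb H_{\mathbb Z}$ is the direct product monoid. *)

theory Defs
  imports "HOL-Algebra.Group" "HOL-Library.Numeral_Type"
begin

section \<open>Walks on the cube graph\<close>

text \<open>
  The coordinates are the elements \<open>0\<close>, \<open>1\<close>, \<open>2\<close> of the three-element type \<^typ>\<open>3\<close>, and the
  bits \<open>0\<close>, \<open>1\<close> are \<^const>\<open>False\<close>, \<^const>\<open>True\<close>.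
\<close>

type_synonym coord = 3
type_synonym vertex = "coord \<Rightarrow> bool"

definition cube_adj :: "vertex \<Rightarrow> vertex \<Rightarrow> bool" where
  "cube_adj p q \<longleftrightarrow> (\<exists>!a. p a \<noteq> q a)"

definition base :: vertex where
  "base = (\<lambda>_. False)"

definition flip :: "coord \<Rightarrow> vertex \<Rightarrow> vertex" where
  "flip a p = p(a := \<not> p a)"

lemma cube_adj_iff_flip: "cube_adj p q \<longleftrightarrow> (\<exists>a. q = flip a p)"
  by (auto simp: cube_adj_def flip_def fun_eq_iff Ex1_def; metis)

text \<open>
  A walk is its step sequence \<open>[a\<^sub>1, \<dots>, a\<^sub>n]\<close>. List indices start at \<open>0\<close>, so \<open>a\<^sub>k\<close> is
  \<open>w ! (k - 1)\<close>. The value \<open>vert w k\<close> is meaningful only for \<open>k \<le> length w\<close>.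
\<close>

type_synonym walk = "coord list"

primrec vert :: "walk \<Rightarrow> nat \<Rightarrow> vertex" where
  "vert w 0 = base"
| "vert w (Suc k) = flip (w ! k) (vert w k)"

definition closed_walk :: "walk \<Rightarrow> bool" where
  "closed_walk w \<longleftrightarrow> vert w (length w) = base"

definition walk_monoid :: "walk monoid" where
  "walk_monoid = \<lparr>carrier = {w. closed_walk w}, mult = (@), one = []\<rparr>"

section \<open>Directed transition counts\<close>

definition trans_count :: "walk \<Rightarrow> vertex \<times> vertex \<Rightarrow> nat" where
  "trans_count w = (\<lambda>(p, q).
     card {k. 1 \<le> k \<and> k \<le> length w \<and> (vert w (k - 1), vert w k) = (p, q)})"

definition trans_monoid :: "(vertex \<times> vertex \<Rightarrow> nat) monoid" where
  "trans_monoid =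
     \<lparr>carrier = trans_count ` carrier walk_monoid, mult = (\<lambda>s t e. s e + t e), one = (\<lambda>_. 0)\<rparr>"

section \<open>Integer quaternions\<close>

text \<open>\<open>Quat a b c d\<close> stands for \<open>a + b i + c j + d k\<close>.\<close>

datatype int_quat = Quat (qre: int) (qi: int) (qj: int) (qk: int)

instantiation int_quat :: ring_1
begin

definition zero_int_quat :: int_quat where
  "0 = Quat 0 0 0 0"

definition one_int_quat :: int_quat where
  "1 = Quat 1 0 0 0"

definition plus_int_quat :: "int_quat \<Rightarrow> int_quat \<Rightarrow> int_quat" where
  "x + y = Quat (qre x + qre y) (qi x + qi y) (qj x + qj y) (qk x + qk y)"

definition uminus_int_quat :: "int_quat \<Rightarrow> int_quat" where
  "- x = Quat (- qre x) (- qi x) (- qj x) (- qk x)"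

definition minus_int_quat :: "int_quat \<Rightarrow> int_quat \<Rightarrow> int_quat" where
  "x - y = Quat (qre x - qre y) (qi x - qi y) (qj x - qj y) (qk x - qk y)"

definition times_int_quat :: "int_quat \<Rightarrow> int_quat \<Rightarrow> int_quat" where
  "x * y = Quat
     (qre x * qre y - qi x * qi y - qj x * qj y - qk x * qk y)
     (qre x * qi y + qi x * qre y + qj x * qk y - qk x * qj y)
     (qre x * qj y - qi x * qk y + qj x * qre y + qk x * qi y)
     (qre x * qk y + qi x * qj y - qj x * qi y + qk x * qre y)"

instance
  by standard
    (simp_all add: zero_int_quat_def one_int_quat_def plus_int_quat_def uminus_int_quat_def
       minus_int_quat_def times_int_quat_def algebra_simps)

end

definition quat_i :: int_quat where "quat_i = Quat 0 1 0 0"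
definition quat_j :: int_quat where "quat_j = Quat 0 0 1 0"
definition quat_k :: int_quat where "quat_k = Quat 0 0 0 1"

lemma quat_unit_products:
  "quat_i * quat_i = -1" "quat_j * quat_j = -1" "quat_k * quat_k = -1"
  "quat_i * quat_j = quat_k" "quat_j * quat_k = quat_i" "quat_k * quat_i = quat_j"
  by (simp_all add: quat_i_def quat_j_def quat_k_def one_int_quat_def uminus_int_quat_def
        times_int_quat_def)

lemma Quat_eq:
  "Quat a b c d = of_int a + of_int b * quat_i + of_int c * quat_j + of_int d * quat_k"
proof -
  have nat: "of_nat n = Quat (int n) 0 0 0" for n
    by (induction n) (simp_all add: zero_int_quat_def one_int_quat_def plus_int_quat_def)
  have "of_int z = Quat z 0 0 0" for z
    by (cases z rule: int_diff_cases) (simp add: nat minus_int_quat_def)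
  then show ?thesis
    by (simp add: quat_i_def quat_j_def quat_k_def plus_int_quat_def times_int_quat_def)
qed

definition quat_monoid :: "int_quat monoid" where
  "quat_monoid = \<lparr>carrier = UNIV, mult = (*), one = 1\<rparr>"

definition step_quat :: "coord \<Rightarrow> int_quat" where
  "step_quat a = (if a = 0 then 1 + quat_i else if a = 1 then 1 + quat_j else 1 + quat_k)"

definition holonomy :: "walk \<Rightarrow> int_quat" where
  "holonomy w = prod_list (map step_quat w)"

section \<open>Homomorphisms and kernel relations\<close>

text \<open>The library set \<^const>\<open>hom\<close> does not require preservation of the identity.\<close>

definition monoid_hom ::
    "('a, 'm) monoid_scheme \<Rightarrow> ('b, 'n) monoid_scheme \<Rightarrow> ('a \<Rightarrow> 'b) \<Rightarrow> bool" where
  "monoid_hom G H f \<longleftrightarrow> monoid G \<and> monoid H \<and> f \<in> hom G H \<and> f \<one>\<^bsub>G\<^esub> = \<one>\<^bsub>H\<^esub>"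

definition ker_rel :: "(walk \<Rightarrow> 'b) \<Rightarrow> (walk \<times> walk) set" where
  "ker_rel r = {(x, y). x \<in> carrier walk_monoid \<and> y \<in> carrier walk_monoid \<and> r x = r y}"

definition count_hol :: "walk \<Rightarrow> (vertex \<times> vertex \<Rightarrow> nat) \<times> int_quat" where
  "count_hol w = (trans_count w, holonomy w)"

end

theory Submission
  imports Defs
begin

text \<open>
  Concatenating a closed walk \<open>x\<close> with a walk \<open>y\<close> puts the vertex sequence of \<open>y\<close>, again based at
  the origin, after that of \<open>x\<close>. Hence transition counts are additive on closed walks
  (\<open>trans_count_append\<close>), while \<^const>\<open>holonomy\<close> is multiplicative because it is a product along
  the step sequence. This gives the homomorphism property. It also shows that \<open>x @ y\<close> and \<open>y @ x\<close>
  have equal transition counts for all closed \<open>x\<close> and \<open>y\<close>, whereas \<^const>\<open>holonomy\<close> sees whether the quaternions of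
  \<open>x\<close> and \<open>y\<close> commute. Both strict inclusions come from back-and-forth walks: the holonomy of \<open>00\<close>
  is \<open>2 i\<close> and that of \<open>11\<close> is \<open>2 j\<close>. These anticommute, so \<open>0011\<close> and \<open>1100\<close> are separated by
  the holonomy. But \<open>1111\<close> has holonomy \<open>(2 j)\<^sup>2 = - 4\<close>, which is central, so the distinct walks
  \<open>001111\<close> and \<open>111100\<close> have the same counts and the same holonomy.
\<close>

lemma vert_append_left: "k \<le> length x \<Longrightarrow> vert (x @ y) k = vert x k"
  by (induction k) (simp_all add: nth_append)

lemma vert_append_right:
  assumes "closed_walk x"
  shows "vert (x @ y) (length x + k) = vert y k"
  using assms by (induction k) (simp_all add: closed_walk_def vert_append_left nth_append)

lemma closed_walk_append: "closed_walk x \<Longrightarrow> closed_walk y \<Longrightarrow> closed_walk (x @ y)"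
  using vert_append_right[of x y "length y"] by (simp add: closed_walk_def)

text \<open>Indexing each transition by its source position, counted from \<open>0\<close>, lets the positions in a
  concatenation split into those below \<open>length x\<close> and a shifted copy of those of \<open>y\<close>.\<close>

lemma trans_count_card:
  "trans_count w (p, q) = card {k. k < length w \<and> vert w k = p \<and> vert w (Suc k) = q}"
proof -
  have "{k. 1 \<le> k \<and> k \<le> length w \<and> (vert w (k - 1), vert w k) = (p, q)}
      = Suc ` {k. k < length w \<and> vert w k = p \<and> vert w (Suc k) = q}" (is "?L = Suc ` ?R")
  proof (intro Set.set_eqI iffI)
    fix k assume "k \<in> ?L"
    then show "k \<in> Suc ` ?R" by (cases k) auto
  qed auto
  then show ?thesis
    by (simp only: trans_count_def prod.case card_image[OF inj_Suc])
qed

lemma trans_count_append: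
  assumes "closed_walk x"
  shows "trans_count (x @ y) e = trans_count x e + trans_count y e"
proof (cases e)
  case (Pair p q)
  let ?S = "\<lambda>w. {k. k < length w \<and> vert w k = p \<and> vert w (Suc k) = q}"
  let ?shift = "\<lambda>k. length x + k"
  have left: "vert (x @ y) k = vert x k \<and> vert (x @ y) (Suc k) = vert x (Suc k)"
    if "k < length x" for k
    using that vert_append_left[of k x y] vert_append_left[of "Suc k" x y] by simp
  have right: "vert (x @ y) (length x + k) = vert y k
      \<and> vert (x @ y) (Suc (length x + k)) = vert y (Suc k)" for k
    using vert_append_right[OF assms, of y k] vert_append_right[OF assms, of y "Suc k"]
    by (simp only: add_Suc_right simp_thms)
  have "?S (x @ y) = ?S x \<union> ?shift ` ?S y"
  proof (rule Set.set_eqI)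
    fix k
    show "k \<in> ?S (x @ y) \<longleftrightarrow> k \<in> ?S x \<union> ?shift ` ?S y"
    proof (cases "k < length x")
      case True
      with left[OF True] show ?thesis by (auto simp del: vert.simps)
    next
      case False
      then obtain m where "k = length x + m" by (metis le_add_diff_inverse not_less)
      with right[of m] show ?thesis by (auto simp del: vert.simps)
    qed
  qed
  moreover have "?S x \<inter> ?shift ` ?S y = {}" by auto
  moreover have "card (?shift ` ?S y) = card (?S y)" by (simp add: card_image)
  ultimately show ?thesis
    by (simp only: Pair trans_count_card) (subst card_Un_disjoint, simp_all)
qed

lemma trans_count_Nil: "trans_count [] = (\<lambda>_. 0)"
  by (auto simp: trans_count_def)

lemma trans_count_append_commute:
  "closed_walk x \<Longrightarrow> closed_walk y \<Longrightarrow> trans_count (x @ y) = trans_count (y @ x)"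
  by (rule ext) (simp add: trans_count_append)

lemma holonomy_append: "holonomy (x @ y) = holonomy x * holonomy y"
  by (simp add: holonomy_def)

lemma monoid_walk_monoid: "monoid walk_monoid"
  by (rule monoidI) (auto simp: walk_monoid_def closed_walk_append, simp add: closed_walk_def)

lemma monoid_trans_monoid: "monoid trans_monoid"
proof (rule monoidI)
  fix s t assume "s \<in> carrier trans_monoid" "t \<in> carrier trans_monoid"
  then obtain x y where xy: "closed_walk x" "closed_walk y" "s = trans_count x" "t = trans_count y"
    by (auto simp: trans_monoid_def walk_monoid_def)
  then have "s \<otimes>\<^bsub>trans_monoid\<^esub> t = trans_count (x @ y)"
    by (auto simp: trans_monoid_def trans_count_append)
  then show "s \<otimes>\<^bsub>trans_monoid\<^esub> t \<in> carrier trans_monoid"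
    using xy by (simp add: trans_monoid_def walk_monoid_def closed_walk_append)
next
  have "closed_walk []" by (simp add: closed_walk_def)
  then show "\<one>\<^bsub>trans_monoid\<^esub> \<in> carrier trans_monoid"
    by (auto simp: trans_monoid_def walk_monoid_def image_iff trans_count_Nil intro!: exI[of _ "[]"])
qed (auto simp: trans_monoid_def add.assoc)

lemma monoid_quat_monoid: "monoid quat_monoid"
  by (rule monoidI) (simp_all add: quat_monoid_def mult.assoc)

lemma monoid_hom_count_hol:
  "monoid_hom walk_monoid (trans_monoid \<times>\<times> quat_monoid) count_hol"
  unfolding monoid_hom_def
proof (intro conjI)
  show "monoid (trans_monoid \<times>\<times> quat_monoid)"
    by (intro DirProd_monoid monoid_trans_monoid monoid_quat_monoid)
  show "count_hol \<in> hom walk_monoid (trans_monoid \<times>\<times> quat_monoid)"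
    by (auto simp: hom_def walk_monoid_def trans_monoid_def quat_monoid_def DirProd_def
        count_hol_def trans_count_append holonomy_append)
  show "count_hol \<one>\<^bsub>walk_monoid\<^esub> = \<one>\<^bsub>trans_monoid \<times>\<times> quat_monoid\<^esub>"
    by (simp add: walk_monoid_def trans_monoid_def quat_monoid_def DirProd_def
        count_hol_def trans_count_Nil holonomy_def)
qed (rule monoid_walk_monoid)

lemma closed_walk_back_and_forth: "closed_walk [a, a]"
  by (simp add: closed_walk_def flip_def)

lemma holonomy_00: "holonomy [0, 0] = Quat 0 2 0 0"
  and holonomy_11: "holonomy [1, 1] = Quat 0 0 2 0"
  by (simp_all add: holonomy_def step_quat_def quat_i_def quat_j_def one_int_quat_def
      plus_int_quat_def times_int_quat_def)

theorem theorem7p1: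
  shows "monoid_hom walk_monoid (trans_monoid \<times>\<times> quat_monoid) count_hol
    \<and> Id_on (carrier walk_monoid) \<subset> ker_rel count_hol
    \<and> ker_rel count_hol \<subset> ker_rel trans_count"
proof (intro conjI psubsetI)
  define x y :: walk where "x = [0, 0]" and "y = [1, 1]"
  have cx: "closed_walk x" and cy: "closed_walk y"
    by (simp_all add: x_def y_def closed_walk_back_and_forth)
  have cyy: "closed_walk (y @ y)" using cy by (simp add: closed_walk_append)
  have hx: "holonomy x = Quat 0 2 0 0" and hy: "holonomy y = Quat 0 0 2 0"
    by (simp_all only: x_def y_def holonomy_00 holonomy_11)
  show "Id_on (carrier walk_monoid) \<noteq> ker_rel count_hol"
  proof -
    \<comment> \<open>\<open>y\<close> is doubled so that its holonomy becomes the central element \<open>- 4\<close>.\<close>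
    have "count_hol (x @ y @ y) = count_hol ((y @ y) @ x)"
      using trans_count_append_commute[OF cx cyy]
      by (simp add: count_hol_def holonomy_append hx hy times_int_quat_def)
    then have "(x @ y @ y, (y @ y) @ x) \<in> ker_rel count_hol"
      using closed_walk_append[OF cx cyy] closed_walk_append[OF cyy cx]
      by (simp only: ker_rel_def walk_monoid_def) simp
    moreover have "x @ y @ y \<noteq> (y @ y) @ x" by (simp add: x_def y_def)
    then have "(x @ y @ y, (y @ y) @ x) \<notin> Id_on (carrier walk_monoid)"
      by (simp only: Id_on_iff simp_thms)
    ultimately show ?thesis by metis
  qed
  show "ker_rel count_hol \<noteq> ker_rel trans_count"
  proof -
    have "(x @ y, y @ x) \<in> ker_rel trans_count"
      using closed_walk_append[OF cx cy] closed_walk_append[OF cy cx]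
        trans_count_append_commute[OF cx cy]
      by (simp add: ker_rel_def walk_monoid_def)
    moreover have "holonomy (x @ y) \<noteq> holonomy (y @ x)"
      by (simp add: holonomy_append hx hy times_int_quat_def)
    then have "(x @ y, y @ x) \<notin> ker_rel count_hol"
      by (simp add: ker_rel_def count_hol_def)
    ultimately show ?thesis by metis
  qed
qed (auto simp: monoid_hom_count_hol ker_rel_def count_hol_def)

end
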